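(* Let $(A,\cdot)$ be an anti-flexible algebra over a field $\mathbb{K}$ of characteristic different from $2$, let $M$ be an $A$-bimodule, and let $T:M\to A$ be an $\mathcal{O}$-operator on $A$ with respect to the bimodule $M$. Then $M$ is a pre-anti-flexible algebra with the products given for all $m,n\in M$ by $$m\prec n=mT(n),\qquad m\succ n=T(m)n.$$
   Context: An anti-flexible algebra is a $\mathbb{K}$-vector space $A$ with a bilinear product $\cdot$ such that $(x\cdot y)\cdot z-x\cdot(y\cdot z)=(z\cdot y)\cdot x-z\cdot(y\cdot x)$ for all $x,y,z\in A$. An $A$-bimodule is a vector space $M$ with bilinear left and right actions $A\times M\to M$, $(a,m)\mapsto am$, and $M\times A\to M$, $(m,a)\mapsto ma$, such that for all $a,b\in A$, $m\in M$: $(a\cdot b)m-a(bm)-(mb)a+m(b\cdot a)=0$ and $a(mb)-(am)b-b(ma)+(bm)a=0$. An $\mathcal{O}$-operator on $A$ with respect to $M$ is a linear map $T:M\to A$ with $T(m)\cdot T(n)=T(mT(n)+T(m)n)$ for all $m,n\in M$. A pre-anti-flexible algebra is a vector space with two bilinear products $\prec,\succ$ such that for all $x,y,z$: (i) $(x\succ y)\prec z-x\succ(y\prec z)=(z\succ y)\prec x-z\succ(y\prec x)$; (ii) $(x\succ y+x\prec y)\succ z-x\succ(y\succ z)=(z\prec y)\prec x-z\prec(y\prec x+y\succ x)$. *)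

theory Defs
  imports Complex_Main
begin

text \<open>
  A vector space is given by its scalar multiplication, as in \<^locale>\<open>vector_space\<close>.
  The library's own notion of a bilinear map covers real vector spaces only.
\<close>

locale bilinear_map =
  vs1: vector_space s1 + vs2: vector_space s2 + vs3: vector_space s3
  for s1 :: "'k::field \<Rightarrow> 'a::ab_group_add \<Rightarrow> 'a"
    and s2 :: "'k \<Rightarrow> 'b::ab_group_add \<Rightarrow> 'b"
    and s3 :: "'k \<Rightarrow> 'c::ab_group_add \<Rightarrow> 'c" +
  fixes f :: "'a \<Rightarrow> 'b \<Rightarrow> 'c"
  assumes linear_left: "Vector_Spaces.linear s1 s3 (\<lambda>x. f x y)"
    and linear_right: "Vector_Spaces.linear s2 s3 (f x)"

locale anti_flexible_algebra =
  bilinear_map sA sA sA mul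
  for sA :: "'k::field \<Rightarrow> 'a::ab_group_add \<Rightarrow> 'a"
    and mul :: "'a \<Rightarrow> 'a \<Rightarrow> 'a" (infixl \<open>\<cdot>\<close> 70) +
  assumes anti_flexible:
    "(x \<cdot> y) \<cdot> z - x \<cdot> (y \<cdot> z) = (z \<cdot> y) \<cdot> x - z \<cdot> (y \<cdot> x)"

locale anti_flexible_bimodule =
  anti_flexible_algebra sA mul +
  left: bilinear_map sA sM sM lact +
  right: bilinear_map sM sA sM ract
  for sA :: "'k::field \<Rightarrow> 'a::ab_group_add \<Rightarrow> 'a"
    and mul :: "'a \<Rightarrow> 'a \<Rightarrow> 'a" (infixl \<open>\<cdot>\<close> 70)
    and sM :: "'k \<Rightarrow> 'm::ab_group_add \<Rightarrow> 'm"
    and lact :: "'a \<Rightarrow> 'm \<Rightarrow> 'm" (infixr \<open>\<rhd>\<close> 75)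
    and ract :: "'m \<Rightarrow> 'a \<Rightarrow> 'm" (infixl \<open>\<lhd>\<close> 75) +
  assumes bimodule_1:
      "(a \<cdot> b) \<rhd> m - a \<rhd> (b \<rhd> m) - (m \<lhd> b) \<lhd> a + m \<lhd> (b \<cdot> a) = 0"
    and bimodule_2:
      "a \<rhd> (m \<lhd> b) - (a \<rhd> m) \<lhd> b - b \<rhd> (m \<lhd> a) + (b \<rhd> m) \<lhd> a = 0"

locale O_operator =
  anti_flexible_bimodule sA mul sM lact ract +
  Vector_Spaces.linear sM sA T
  for sA :: "'k::field \<Rightarrow> 'a::ab_group_add \<Rightarrow> 'a"
    and mul :: "'a \<Rightarrow> 'a \<Rightarrow> 'a" (infixl \<open>\<cdot>\<close> 70)
    and sM :: "'k \<Rightarrow> 'm::ab_group_add \<Rightarrow> 'm"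
    and lact :: "'a \<Rightarrow> 'm \<Rightarrow> 'm" (infixr \<open>\<rhd>\<close> 75)
    and ract :: "'m \<Rightarrow> 'a \<Rightarrow> 'm" (infixl \<open>\<lhd>\<close> 75)
    and T :: "'m \<Rightarrow> 'a" +
  assumes O_operator: "T m \<cdot> T n = T (m \<lhd> T n + T m \<rhd> n)"

locale pre_anti_flexible_algebra =
  prec: bilinear_map s s s prec +
  succ: bilinear_map s s s succ
  for s :: "'k::field \<Rightarrow> 'a::ab_group_add \<Rightarrow> 'a"
    and prec :: "'a \<Rightarrow> 'a \<Rightarrow> 'a" (infixl \<open>\<prec>\<close> 70)
    and succ :: "'a \<Rightarrow> 'a \<Rightarrow> 'a" (infixl \<open>\<succ>\<close> 70) +
  assumes pre_anti_flexible_1: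
      "(x \<succ> y) \<prec> z - x \<succ> (y \<prec> z) = (z \<succ> y) \<prec> x - z \<succ> (y \<prec> x)"
    and pre_anti_flexible_2:
      "(x \<succ> y + x \<prec> y) \<succ> z - x \<succ> (y \<succ> z)
        = (z \<prec> y) \<prec> x - z \<prec> (y \<prec> x + y \<succ> x)"

end

theory Submission
  imports Defs
begin

text \<open>Both products are a module action with one argument pulled back along the linear map
  \<open>T\<close>, so they are bilinear by the two composition lemmas below. Axiom (i) only
  involves single values of \<open>T\<close>, and is the second bimodule law at \<open>T x\<close>
  and \<open>T z\<close>. In axiom (ii), \<open>T\<close> is applied to sums of the two products;
  the operator identity turns these into products in the algebra, and what remains is the first
  bimodule law at \<open>T x\<close> and \<open>T y\<close>.\<close>

lemma bilinear_map_compose_left: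
  assumes "bilinear_map s1 s2 s3 f" and "Vector_Spaces.linear s s1 T"
  shows "bilinear_map s s2 s3 (\<lambda>x y. f (T x) y)"
proof -
  interpret f: bilinear_map s1 s2 s3 f by fact
  interpret T: Vector_Spaces.linear s s1 T by fact
  show ?thesis
    using Vector_Spaces.linear_compose[OF assms(2) f.linear_left] f.linear_right
    by (intro bilinear_map.intro bilinear_map_axioms.intro)
      (simp_all add: o_def f.vs1.vector_space_axioms f.vs2.vector_space_axioms
        f.vs3.vector_space_axioms T.vs1.vector_space_axioms)
qed

lemma bilinear_map_compose_right:
  assumes "bilinear_map s1 s2 s3 f" and "Vector_Spaces.linear s s2 T"
  shows "bilinear_map s1 s s3 (\<lambda>x y. f x (T y))"
proof -
  interpret f: bilinear_map s1 s2 s3 f by fact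
  interpret T: Vector_Spaces.linear s s2 T by fact
  show ?thesis
    using Vector_Spaces.linear_compose[OF assms(2) f.linear_right] f.linear_left
    by (intro bilinear_map.intro bilinear_map_axioms.intro)
      (simp_all add: o_def f.vs1.vector_space_axioms f.vs2.vector_space_axioms
        f.vs3.vector_space_axioms T.vs1.vector_space_axioms)
qed

theorem proposition3p8:
  fixes sA :: "'k::field \<Rightarrow> 'a::ab_group_add \<Rightarrow> 'a"
    and mul :: "'a \<Rightarrow> 'a \<Rightarrow> 'a"
    and sM :: "'k \<Rightarrow> 'm::ab_group_add \<Rightarrow> 'm"
    and lact :: "'a \<Rightarrow> 'm \<Rightarrow> 'm"
    and ract :: "'m \<Rightarrow> 'a \<Rightarrow> 'm"
    and T :: "'m \<Rightarrow> 'a"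
  assumes "CHAR('k) \<noteq> 2"
    and "anti_flexible_algebra sA mul"
    and "anti_flexible_bimodule sA mul sM lact ract"
    and "O_operator sA mul sM lact ract T"
  shows "pre_anti_flexible_algebra sM (\<lambda>m n. ract m (T n)) (\<lambda>m n. lact (T m) n)"
proof -
  interpret O_operator sA mul sM lact ract T by fact
  have T: "Vector_Spaces.linear sM sA T" by unfold_locales
  interpret prec: bilinear_map sM sM sM "\<lambda>m n. ract m (T n)"
    by (rule bilinear_map_compose_right[OF right.bilinear_map_axioms T])
  interpret succ: bilinear_map sM sM sM "\<lambda>m n. lact (T m) n"
    by (rule bilinear_map_compose_left[OF left.bilinear_map_axioms T])
  show ?thesis
  proof
    fix x y z
    \<comment> \<open>The middle element \<open>y\<close> is the module element of the law; the
      outer two enter through \<open>T\<close>. The law, with its four terms rearranged, is exactly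
      this equation.\<close>
    show "ract (lact (T x) y) (T z) - lact (T x) (ract y (T z))
        = ract (lact (T z) y) (T x) - lact (T z) (ract y (T x))"
      using bimodule_2[of "T x" y "T z"] by (simp add: algebra_simps)
    \<comment> \<open>The next two facts remove the nested \<open>T\<close> on either side of axiom
      (ii). Here the summands stand in the opposite order to the operator identity, hence
      \<open>add.commute\<close>.\<close>
    have "T (lact (T x) y + ract x (T y)) = mul (T x) (T y)"
      by (simp add: O_operator add.commute)
    moreover have "T (ract y (T x) + lact (T y) x) = mul (T y) (T x)"
      by (simp add: O_operator)
    ultimately show "lact (T (lact (T x) y + ract x (T y))) z - lact (T x) (lact (T y) z)
        = ract (ract z (T y)) (T x) - ract z (T (ract y (T x) + lact (T y) x))"
      using bimodule_1[of "T x" "T y" z] by (simp add: algebra_simps)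
  qed
qed

end
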